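(* Let ${\cal D}=(V,{\cal B})$ be a BIBD$(v,k,1)$ whose block set ${\cal B}$ contains a parallel class $\pi$. Then there exists a $k$-GDD ${\cal D}_\pi$ of type $k^{v/k}$ such that \[\chi({\cal D})\ge\chi({\cal D}_\pi)\ge\chi({\cal D})-\left\lceil\frac{v}{k(k-1)}\right\rceil.\]
   Context: A BIBD$(v,k,1)$ is a pair $(V,{\cal B})$ with $|V|=v$ and ${\cal B}$ a collection of $k$-subsets (blocks) of $V$ such that every pair of distinct points lies in exactly one block. A parallel class is a set of $v/k$ blocks partitioning $V$. A $k$-GDD of type $g^u$ is a triple $(V,{\cal G},{\cal B})$ where ${\cal G}$ partitions $V$ into $u$ groups of size $g$ and ${\cal B}$ is a collection of $k$-subsets (blocks) such that every pair of distinct points lies in exactly one block or in exactly one group, but not both. A weak $c$-colouring is a map from the points to $c$ colours with no monochromatic block; the chromatic number $\chi$ is the least such $c$. *)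

theory Defs
  imports Complex_Main "HOL-Library.Disjoint_Sets" "HOL-Library.FuncSet"
begin

text \<open>
  Block collections are sets rather than multisets: for \<open>k \<ge> 2\<close>, a repeated block would
  put a pair of points into more than one block.
\<close>

definition bibd1 :: "nat \<Rightarrow> nat \<Rightarrow> 'a set \<Rightarrow> 'a set set \<Rightarrow> bool" where
  "bibd1 v k V \<B> \<longleftrightarrow>
     finite V \<and> card V = v \<and>
     (\<forall>b\<in>\<B>. b \<subseteq> V \<and> card b = k) \<and>
     (\<forall>x\<in>V. \<forall>y\<in>V. x \<noteq> y \<longrightarrow> (\<exists>!b. b \<in> \<B> \<and> {x, y} \<subseteq> b))"

text \<open>
  The truncated quotient in the next definition is exact for \<open>k\<close>-element blocks (see
  \<open>parallel_class_card\<close> below).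
\<close>

definition parallel_class :: "nat \<Rightarrow> 'a set \<Rightarrow> 'a set set \<Rightarrow> 'a set set \<Rightarrow> bool" where
  "parallel_class k V \<B> P \<longleftrightarrow> P \<subseteq> \<B> \<and> card P = card V div k \<and> partition_on V P"

text \<open>
  \<open>gdd k g u V \<G> \<B>\<close>: a \<open>k\<close>-GDD of type \<open>g\<^sup>u\<close>. The last clause is an exclusive
  disjunction in the strong sense: one block and no group, or one group and no block.
\<close>

definition gdd ::
  "nat \<Rightarrow> nat \<Rightarrow> nat \<Rightarrow> 'a set \<Rightarrow> 'a set set \<Rightarrow> 'a set set \<Rightarrow> bool" where
  "gdd k g u V \<G> \<B> \<longleftrightarrow>
     finite V \<and>
     partition_on V \<G> \<and> card \<G> = u \<and> (\<forall>G\<in>\<G>. card G = g) \<and>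
     (\<forall>b\<in>\<B>. b \<subseteq> V \<and> card b = k) \<and>
     (\<forall>x\<in>V. \<forall>y\<in>V. x \<noteq> y \<longrightarrow>
        (\<exists>!b. b \<in> \<B> \<and> {x, y} \<subseteq> b) \<and> \<not> (\<exists>G\<in>\<G>. {x, y} \<subseteq> G) \<or>
        (\<exists>!G. G \<in> \<G> \<and> {x, y} \<subseteq> G) \<and> \<not> (\<exists>b\<in>\<B>. {x, y} \<subseteq> b))"

definition monochromatic :: "('a \<Rightarrow> nat) \<Rightarrow> 'a set \<Rightarrow> bool" where
  "monochromatic f b \<longleftrightarrow> (\<exists>a. \<forall>x\<in>b. f x = a)"

definition weak_colouring :: "nat \<Rightarrow> 'a set \<Rightarrow> 'a set set \<Rightarrow> ('a \<Rightarrow> nat) \<Rightarrow> bool" where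
  "weak_colouring c V \<B> f \<longleftrightarrow> f \<in> V \<rightarrow> {..<c} \<and> (\<forall>b\<in>\<B>. \<not> monochromatic f b)"

definition chromatic_number :: "'a set \<Rightarrow> 'a set set \<Rightarrow> nat" where
  "chromatic_number V \<B> = (LEAST c. \<exists>f. weak_colouring c V \<B> f)"

lemma parallel_class_card:
  assumes "bibd1 v k V \<B>" "parallel_class k V \<B> P"
  shows "k * card P = v"
proof -
  have p: "partition_on V P" and s: "P \<subseteq> \<B>"
    using assms(2) by (auto simp: parallel_class_def)
  have f: "finite V" and c: "card V = v" and k: "\<And>b. b \<in> P \<Longrightarrow> card b = k \<and> b \<subseteq> V"
    using assms(1) s by (auto simp: bibd1_def)
  have "card V = (\<Sum>b\<in>P. card b)"
    using p k f by (metis card_Union_disjoint finite_subset partition_onD1 partition_onD2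
        disjoint_def pairwise_def disjnt_def)
  also have "\<dots> = k * card P"
    using k by simp
  finally show ?thesis
    using c by simp
qed

text \<open>
  The \<open>LEAST\<close> in the definition of the chromatic number is over a nonempty set as soon as
  all blocks have at least two points.
\<close>

lemma weak_colouring_exists:
  assumes "finite V" "\<forall>b\<in>\<B>. b \<subseteq> V \<and> card b \<ge> 2"
  shows "\<exists>c f. weak_colouring c V \<B> f"
proof -
  obtain f where f: "bij_betw f V {0..<card V}"
    using assms(1) ex_bij_betw_finite_nat by blast
  have "\<not> monochromatic f b" if b: "b \<in> \<B>" for b
  proof
    assume "monochromatic f b"
    then obtain a where a: "\<forall>x\<in>b. f x = a"
      by (auto simp: monochromatic_def)
    have "inj_on f b"
      using f assms(2) b by (meson bij_betw_imp_inj_on inj_on_subset)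
    then have "\<forall>x\<in>b. \<forall>y\<in>b. x = y"
      using a by (metis inj_onD)
    then have "card b \<le> Suc 0"
      by (metis card_le_Suc0_iff_eq card.infinite le0)
    then show False
      using assms(2) b by force
  qed
  moreover have "f \<in> V \<rightarrow> {..<card V}"
    using f by (auto simp: bij_betw_def)
  ultimately show ?thesis
    unfolding weak_colouring_def by blast
qed

end

theory Submission
  imports Defs
begin

text \<open>
  Turn the blocks of the parallel class into groups. A colouring of the resulting GDD can only
  fail on blocks of the parallel class, so it suffices to recolour one point in each of these at
  most \<open>v / k\<close> blocks. Using every new colour on at most \<open>k - 1\<close> points makes no
  block monochromatic in a new colour.
\<close>

lemma chromatic_number_le: "weak_colouring c V \<B> f \<Longrightarrow> chromatic_number V \<B> \<le> c"
  unfolding chromatic_number_def by (rule Least_le) blast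

lemma chromatic_number_attained:
  assumes "finite V" "\<forall>b\<in>\<B>. b \<subseteq> V \<and> card b \<ge> 2"
  obtains f where "weak_colouring (chromatic_number V \<B>) V \<B> f"
  using LeastI_ex[OF weak_colouring_exists[OF assms]] unfolding chromatic_number_def by blast

lemma weak_colouring_antimono:
  "weak_colouring c V \<B> f \<Longrightarrow> \<A> \<subseteq> \<B> \<Longrightarrow> weak_colouring c V \<A> f"
  unfolding weak_colouring_def by blast

text \<open>An optimal colouring for \<open>\<B>\<close> also works for every subcollection. This
  gives the upper bound on the chromatic number of the GDD.\<close>

lemma chromatic_number_mono:
  assumes "finite V" "\<forall>b\<in>\<B>. b \<subseteq> V \<and> card b \<ge> 2" "\<A> \<subseteq> \<B>"
  shows "chromatic_number V \<A> \<le> chromatic_number V \<B>"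
  by (meson assms chromatic_number_attained chromatic_number_le weak_colouring_antimono)

text \<open>Numbers with a common quotient by \<open>m\<close> lie in one interval of length
  \<open>m\<close>. It bounds the number of points that receive the same new colour.\<close>

lemma card_le_if_div_const:
  fixes h :: "'a \<Rightarrow> nat"
  assumes "inj_on h S" "m > 0" "\<And>x. x \<in> S \<Longrightarrow> h x div m = q"
  shows "card S \<le> m"
proof -
  have "h x \<in> {q * m..<q * m + m}" if "x \<in> S" for x
    using div_times_less_eq_dividend[of "h x" m] dividend_less_div_times[OF assms(2), of "h x"]
      assms(3)[OF that] by simp
  then have "h ` S \<subseteq> {q * m..<q * m + m}"
    by blast
  then have "card (h ` S) \<le> card {q * m..<q * m + m}"
    by (rule card_mono[rotated]) simp
  then show ?thesis
    using card_image[OF assms(1)] by simp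
qed

text \<open>After recolouring \<open>T\<close> with \<open>n\<close> new colours, a block inside
  \<open>T\<close> has too many points for one new colour, a block missing \<open>T\<close> keeps
  its old colours and was not monochromatic, and any other block shows both an old and a new
  colour.\<close>

lemma weak_colouring_recolour_transversal:
  assumes range: "f \<in> V \<rightarrow> {..<c}"
    and blocks: "\<And>b. b \<in> \<B> \<Longrightarrow> b \<subseteq> V \<and> card b = k"
    and k: "k \<ge> 2"
    and T: "finite T" "card T \<le> n * (k - 1)"
    and hit: "\<And>b. b \<in> \<B> \<Longrightarrow> monochromatic f b \<Longrightarrow> b \<inter> T \<noteq> {}"
  obtains g where "weak_colouring (c + n) V \<B> g"
proof -
  obtain h where h: "bij_betw h T {0..<card T}"
    using ex_bij_betw_finite_nat[OF T(1)] by blast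
  \<comment> \<open>The quotient cuts the numbering \<open>h\<close> of \<open>T\<close> into runs
    of at most \<open>k - 1\<close> points, one colour per run; the offset \<open>c\<close> keeps
    new colours apart from old ones.\<close>
  define g where "g x = (if x \<in> T then c + h x div (k - 1) else f x)" for x
  have "h x div (k - 1) < n" if "x \<in> T" for x
  proof -
    have "h x < n * (k - 1)"
      using bij_betwE[OF h] that T(2) by fastforce
    then show ?thesis
      by (simp add: less_mult_imp_div_less)
  qed
  then have "g \<in> V \<rightarrow> {..<c + n}"
    using range by (force simp: g_def)
  moreover have "\<not> monochromatic g b" if b: "b \<in> \<B>" for b
  proof
    assume "monochromatic g b"
    then obtain a where a: "\<And>x. x \<in> b \<Longrightarrow> g x = a"
      by (auto simp: monochromatic_def)
    consider "b \<subseteq> T" | "b \<inter> T = {}" | x y where "x \<in> b" "x \<in> T" "y \<in> b" "y \<notin> T"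
      by blast
    then show False
    proof cases
      case 1
      have "inj_on h b"
        using h 1 by (meson bij_betw_imp_inj_on inj_on_subset)
      moreover have "h x div (k - 1) = a - c" if "x \<in> b" for x
        using a[OF that] 1 that by (auto simp: g_def)
      ultimately have "card b \<le> k - 1"
        using card_le_if_div_const[of h b "k - 1"] k by simp
      then show False
        using blocks[OF b] k by simp
    next
      case 2
      then have "f x = a" if "x \<in> b" for x
        using a[OF that] that by (auto simp: g_def)
      then have "monochromatic f b"
        by (auto simp: monochromatic_def)
      then show False
        using hit b 2 by blast
    next
      case 3
      have "c \<le> g x"
        using 3 by (simp add: g_def)
      moreover have "g y < c"
        using 3 range blocks[OF b] by (auto simp: g_def)
      ultimately show False
        using a 3 by force
    qed
  qed
  ultimately show ?thesis
    using that[of g] by (simp add: weak_colouring_def)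
qed

text \<open>The unique block through a pair either lies in \<open>P\<close>, where it now serves as
  the group, or survives in \<open>\<B> - P\<close>; never both.\<close>

lemma gdd_of_parallel_class:
  assumes "bibd1 v k V \<B>" "parallel_class k V \<B> P"
  shows "gdd k k (v div k) V P (\<B> - P)"
proof -
  have sub: "P \<subseteq> \<B>" and part: "partition_on V P"
    using assms(2) by (auto simp: parallel_class_def)
  have "(\<exists>!b. b \<in> \<B> - P \<and> {x, y} \<subseteq> b) \<and> \<not> (\<exists>G\<in>P. {x, y} \<subseteq> G) \<or>
        (\<exists>!G. G \<in> P \<and> {x, y} \<subseteq> G) \<and> \<not> (\<exists>b\<in>\<B> - P. {x, y} \<subseteq> b)"
    if "x \<in> V" "y \<in> V" "x \<noteq> y" for x y
  proof -
    obtain b where b: "b \<in> \<B>" "{x, y} \<subseteq> b" and uniq: "\<And>b'. b' \<in> \<B> \<Longrightarrow> {x, y} \<subseteq> b' \<Longrightarrow> b' = b"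
      using assms(1) \<open>x \<in> V\<close> \<open>y \<in> V\<close> \<open>x \<noteq> y\<close> unfolding bibd1_def by metis
    \<comment> \<open>Both unique existence claims thereby reduce to equality with \<open>b\<close>,
      which leaves only the case split on \<open>b \<in> P\<close>.\<close>
    have "{x, y} \<subseteq> c \<longleftrightarrow> c = b" if "c \<in> \<B>" for c
      using b uniq that by metis
    then have "(c \<in> \<B> - P \<and> {x, y} \<subseteq> c) = (c = b \<and> b \<notin> P)"
      and "(c \<in> P \<and> {x, y} \<subseteq> c) = (c = b \<and> b \<in> P)" for c
      using b(1) sub by (metis DiffD1 DiffD2 DiffI, metis subsetD)
    then show ?thesis
      unfolding Bex_def by (cases "b \<in> P") simp_all
  qed
  then show ?thesis
    using assms sub part unfolding gdd_def bibd1_def parallel_class_def by auto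
qed

lemma chromatic_number_remove_parallel_class:
  assumes k: "k \<ge> 2" and D: "bibd1 v k V \<B>" and P: "parallel_class k V \<B> P"
    and n: "card P \<le> n * (k - 1)"
  shows "chromatic_number V \<B> \<le> chromatic_number V (\<B> - P) + n"
proof -
  have fin: "finite V" and blocks: "\<And>b. b \<in> \<B> \<Longrightarrow> b \<subseteq> V \<and> card b = k"
    using D by (auto simp: bibd1_def)
  have part: "partition_on V P"
    using P by (simp add: parallel_class_def)
  have finP: "finite P"
    using finite_elements[OF fin part] .
  obtain f where f: "weak_colouring (chromatic_number V (\<B> - P)) V (\<B> - P) f"
    by (rule chromatic_number_attained[OF fin, of "\<B> - P"]) (use k blocks in auto)
  \<comment> \<open>One point from each block of \<open>P\<close>, monochromatic or not. The choice
    is proper because the parts of a partition are nonempty.\<close>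
  define T where "T = (\<lambda>b. SOME x. x \<in> b) ` P"
  have "b \<inter> T \<noteq> {}" if "b \<in> \<B>" "monochromatic f b" for b
  proof -
    have "b \<in> P"
      using f that by (auto simp: weak_colouring_def)
    moreover from this have "(SOME x. x \<in> b) \<in> b"
      using partition_onD3[OF part] by (metis some_in_eq)
    ultimately show ?thesis
      by (auto simp: T_def)
  qed
  moreover have "finite T" "card T \<le> n * (k - 1)"
    using finP le_trans[OF card_image_le[OF finP] n] by (auto simp: T_def)
  moreover have "f \<in> V \<rightarrow> {..<chromatic_number V (\<B> - P)}"
    using f by (simp add: weak_colouring_def)
  ultimately obtain g where "weak_colouring (chromatic_number V (\<B> - P) + n) V \<B> g"
    using weak_colouring_recolour_transversal[OF _ blocks k] by metis
  then show ?thesis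
    by (rule chromatic_number_le)
qed

theorem theorem3p9:
  fixes v k :: nat and V :: "'a set" and \<B> P :: "'a set set"
  assumes "k \<ge> 2"
    and "bibd1 v k V \<B>"
    and "parallel_class k V \<B> P"
  shows "\<exists>(V' :: 'a set) \<G> \<B>'. gdd k k (v div k) V' \<G> \<B>' \<and>
           chromatic_number V \<B> \<ge> chromatic_number V' \<B>' \<and>
           int (chromatic_number V' \<B>') \<ge>
             int (chromatic_number V \<B>) - \<lceil>real v / (real k * (real k - 1))\<rceil>"
proof (intro exI conjI)
  \<comment> \<open>This fixes the witnesses left open by \<open>exI\<close>: the same points,
    \<open>P\<close> as groups, and the remaining blocks.\<close>
  show "gdd k k (v div k) V P (\<B> - P)"
    by (rule gdd_of_parallel_class[OF assms(2,3)])
  show "chromatic_number V (\<B> - P) \<le> chromatic_number V \<B>"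
    using assms(1,2) by (intro chromatic_number_mono) (auto simp: bibd1_def)
  define q where "q = real v / (real k * (real k - 1))"
  \<comment> \<open>As \<open>v = k * card P\<close>, \<open>q\<close> equals
    \<open>card P / (k - 1)\<close>, so \<open>n\<close> is the least number of new colours that
    suffices when each is used at most \<open>k - 1\<close> times.\<close>
  define n where "n = nat \<lceil>q\<rceil>"
  have q: "q \<ge> 0"
    using assms(1) by (simp add: q_def)
  have "real v = real k * real (card P)"
    using parallel_class_card[OF assms(2,3)] by (metis of_nat_mult)
  then have "real (card P) = q * (real k - 1)"
    using assms(1) by (simp add: q_def)
  also have "\<dots> \<le> real n * (real k - 1)"
    using assms(1) by (intro mult_right_mono) (auto simp: n_def intro: real_nat_ceiling_ge)
  \<comment> \<open>Here \<open>k \<ge> 2\<close> makes the truncated difference agree with the real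
    one.\<close>
  also have "\<dots> = real (n * (k - 1))"
    using assms(1) by simp
  finally have "card P \<le> n * (k - 1)"
    by (simp only: of_nat_le_iff)
  then have "chromatic_number V \<B> \<le> chromatic_number V (\<B> - P) + n"
    by (rule chromatic_number_remove_parallel_class[OF assms])
  \<comment> \<open>\<open>nat\<close> cuts nothing off, since \<open>q\<close> is
    nonnegative.\<close>
  moreover have "int n = \<lceil>q\<rceil>"
    using q by (simp add: n_def)
  ultimately show "int (chromatic_number V (\<B> - P)) \<ge>
      int (chromatic_number V \<B>) - \<lceil>real v / (real k * (real k - 1))\<rceil>"
    unfolding q_def[symmetric] by linarith
qed

end
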